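(* Let $N\ge1$ and $T>0$. There exist a compact ball $\mathcal K\subset\mathbb R^N$, a map $f\in C_c^\infty(\mathbb R^N;\mathbb R^N)$, and a constant $c>0$ such that $$\sup_{x\in\mathcal K}|\Psi^T(x)-f(x)|\ge c$$ for every continuous autonomous semiflow $(\Psi^t)_{t\ge0}$ on $\mathbb R^N$. Consequently, the set of time-$T$ maps (restricted to $\mathcal K$) of continuous autonomous semiflows on $\mathbb R^N$ is not dense in $C(\mathcal K;\mathbb R^N)$ in the uniform topology.
   Context: A continuous autonomous semiflow on $\mathbb R^N$ is a family $(\Psi^t)_{t\ge0}$ of maps $\Psi^t:\mathbb R^N\to\mathbb R^N$ such that $(t,x)\mapsto\Psi^t(x)$ is continuous on $[0,\infty)\times\mathbb R^N$, $\Psi^0=\mathrm{Id}$, and $\Psi^{t+s}=\Psi^t\circ\Psi^s$ for all $s,t\ge0$. *)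

theory Defs
  imports "HOL-Analysis.Analysis"
begin

text \<open>
  The values \<open>\<Psi> t\<close> for \<open>t < 0\<close> are unconstrained: the family is indexed by \<open>[0, \<infinity>)\<close>.
\<close>

definition continuous_semiflow :: "(real \<Rightarrow> 'a::topological_space \<Rightarrow> 'a) \<Rightarrow> bool"
  where "continuous_semiflow \<Psi> \<longleftrightarrow>
    continuous_on ({0..} \<times> UNIV) (\<lambda>(t, x). \<Psi> t x) \<and>
    \<Psi> 0 = id \<and>
    (\<forall>s\<ge>0. \<forall>t\<ge>0. \<Psi> (t + s) = \<Psi> t \<circ> \<Psi> s)"

text \<open>
  A differentiable map is of class \<open>C\<^sup>k\<^sup>+\<^sup>1\<close> iff all its directional derivatives are of class
  \<open>C\<^sup>k\<close>; in finite dimension this is the usual notion.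
\<close>

primrec Ck :: "nat \<Rightarrow> ('a::euclidean_space \<Rightarrow> 'b::euclidean_space) \<Rightarrow> bool"
  where
    "Ck 0 f \<longleftrightarrow> continuous_on UNIV f"
  | "Ck (Suc k) f \<longleftrightarrow>
      f differentiable_on UNIV \<and> (\<forall>v. Ck k (\<lambda>x. frechet_derivative f (at x) v))"

definition smooth_compactly_supported :: "('a::euclidean_space \<Rightarrow> 'b::euclidean_space) \<Rightarrow> bool"
  where "smooth_compactly_supported f \<longleftrightarrow>
    (\<forall>k. Ck k f) \<and> compact (closure (support_on UNIV f))"

text \<open>
  For compact \<open>K\<close>, the space \<open>C(K; 'b)\<close> with the supremum metric. Its points are functions on
  the whole type that are \<open>undefined\<close> outside \<open>K\<close>, so a map is restricted to \<open>K\<close> by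
  \<^const>\<open>restrict\<close>.
\<close>

abbreviation C_space :: "'a::topological_space set \<Rightarrow> ('a \<Rightarrow> 'b::metric_space) metric"
  where "C_space K \<equiv> cfunspace (top_of_set K) euclidean_metric"

definition time_maps :: "real \<Rightarrow> 'a::topological_space set \<Rightarrow> ('a \<Rightarrow> 'a) set"
  where "time_maps T K = {restrict (\<Psi> T) K | \<Psi>. continuous_semiflow \<Psi>}"

end

theory Submission
  imports Defs
begin

text \<open>
  The map \<open>f\<close> approximately exchanges two points \<open>p\<close> and \<open>q\<close> in a robust way: it sends a ball
  around \<open>p\<close> close to \<open>q\<close>, and a ball around \<open>q\<close> exactly to \<open>p\<close>. Suppose that \<open>\<Psi> T\<close> is uniformly
  close to \<open>f\<close>. Then \<open>\<Psi> (2 T)\<close> maps a closed ball \<open>B\<close> around \<open>p\<close> into its interior, so by Brouwer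
  it has a fixed point \<open>x\<close> inside, and \<open>\<Psi> T x\<close> lies outside \<open>B\<close>. All points of the orbit
  of \<open>x\<close> are fixed by \<open>\<Psi> (2 T)\<close>, but the orbit crosses the boundary of \<open>B\<close>, where \<open>\<Psi> (2 T)\<close>
  has no fixed point.
\<close>

subsection \<open>Semiflows\<close>

lemma continuous_semiflow_continuous_on_space:
  assumes "continuous_semiflow \<Psi>" "t \<ge> 0"
  shows "continuous_on S (\<Psi> t)"
proof -
  have "continuous_on S ((\<lambda>(t, x). \<Psi> t x) \<circ> Pair t)"
    using assms unfolding continuous_semiflow_def
    by (intro continuous_on_compose continuous_intros) (auto elim: continuous_on_subset)
  then show ?thesis
    by (simp add: o_def)
qed

lemma continuous_semiflow_continuous_on_time:
  assumes "continuous_semiflow \<Psi>" "S \<subseteq> {0..}"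
  shows "continuous_on S (\<lambda>t. \<Psi> t x)"
proof -
  have "continuous_on S ((\<lambda>(t, x). \<Psi> t x) \<circ> (\<lambda>t. (t, x)))"
    using assms unfolding continuous_semiflow_def
    by (intro continuous_on_compose continuous_intros) (auto elim: continuous_on_subset)
  then show ?thesis
    by (simp add: o_def)
qed

lemma continuous_semiflow_add:
  assumes "continuous_semiflow \<Psi>" "s \<ge> 0" "t \<ge> 0"
  shows "\<Psi> t (\<Psi> s x) = \<Psi> (t + s) x"
  using assms by (simp add: continuous_semiflow_def)

lemma continuous_semiflow_commute:
  assumes "continuous_semiflow \<Psi>" "s \<ge> 0" "t \<ge> 0"
  shows "\<Psi> t (\<Psi> s x) = \<Psi> s (\<Psi> t x)"
  using assms by (simp add: continuous_semiflow_add add.commute)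

text \<open>Brouwer is applied around \<open>p\<close> only, so the target \<open>B\<close> near the
  second point can be any set disjoint from \<open>cball p r\<close>. The closed ball of the
  overview is \<open>cball p r\<close> here, not \<open>B\<close>.\<close>

lemma continuous_semiflow_no_exchange:
  fixes \<Psi> :: "real \<Rightarrow> 'a::euclidean_space \<Rightarrow> 'a"
  assumes \<Psi>: "continuous_semiflow \<Psi>" and "T \<ge> 0" and "r > 0"
    and to: "\<And>x. x \<in> cball p r \<Longrightarrow> \<Psi> T x \<in> B"
    and fro: "\<And>x. x \<in> B \<Longrightarrow> \<Psi> T x \<in> ball p r"
    and disj: "B \<inter> cball p r = {}"
  shows False
proof -
  define h where "h = \<Psi> T \<circ> \<Psi> T"
  have h: "h x \<in> ball p r" if "x \<in> cball p r" for x
    using to fro that by (simp add: h_def)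
  have "continuous_on (cball p r) h"
    unfolding h_def using \<Psi> \<open>T \<ge> 0\<close>
    by (intro continuous_on_compose continuous_semiflow_continuous_on_space)
  moreover have "h \<in> cball p r \<rightarrow> cball p r"
    using h by (metis Pi_I ball_subset_cball subsetD)
  ultimately obtain x where x: "x \<in> cball p r" "h x = x"
    using brouwer_ball \<open>r > 0\<close> by blast
  have "\<exists>t\<ge>0. t \<le> T \<and> dist p (\<Psi> t x) = r"
  proof (rule IVT')
    show "dist p (\<Psi> 0 x) \<le> r"
      using \<Psi> x by (simp add: continuous_semiflow_def)
    show "r \<le> dist p (\<Psi> T x)"
      using to[OF x(1)] disj by force
    show "continuous_on {0..T} (\<lambda>t. dist p (\<Psi> t x))"
      using \<Psi> by (intro continuous_intros continuous_semiflow_continuous_on_time) auto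
  qed fact
  then obtain t where t: "t \<ge> 0" "dist p (\<Psi> t x) = r"
    by blast
  \<comment> \<open>\<open>h\<close> commutes with the semiflow, so the orbit point on the sphere is
    again fixed by \<open>h\<close>, although \<open>h\<close> maps that sphere into the open
    ball.\<close>
  have "h (\<Psi> t x) = \<Psi> t (h x)"
    using \<Psi> \<open>T \<ge> 0\<close> t(1) by (simp add: h_def continuous_semiflow_commute)
  then have "dist p (\<Psi> t x) < r"
    using h[of "\<Psi> t x"] t(2) x(2) by simp
  then show False
    using t(2) by simp
qed

subsection \<open>A smooth bump function\<close>

text \<open>
  The derivatives of \<open>flat 0\<close>, which is \<open>exp (- 1 / s)\<close> for positive \<open>s\<close>, are linear combinations
  of the functions \<open>flat n\<close>.
\<close>

definition flat :: "nat \<Rightarrow> real \<Rightarrow> real"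
  where "flat n s = (if s > 0 then inverse s ^ n * exp (- inverse s) else 0)"

text \<open>The exponential series at \<open>inverse s\<close> dominates its term of index
  \<open>n + 2\<close>. The two extra powers give quadratic decay, enough for a zero derivative at
  0.\<close>

lemma flat_le_square: "\<bar>flat n s\<bar> \<le> fact (n + 2) * s\<^sup>2"
proof (cases "s > 0")
  case True
  define y where "y = inverse s"
  have "y > 0"
    using True by (simp add: y_def)
  have "(\<Sum>m\<in>{n + 2}. y ^ m /\<^sub>R fact m) \<le> (\<Sum>m. y ^ m /\<^sub>R fact m)"
    using \<open>y > 0\<close> by (intro sum_le_suminf summable_exp_generic) auto
  then have "y ^ (n + 2) /\<^sub>R fact (n + 2) \<le> exp y"
    by (simp add: exp_def)
  then have "y ^ (n + 2) \<le> fact (n + 2) * exp y"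
    by (simp add: field_simps del: fact_Suc)
  then have "y ^ n * exp (- y) \<le> fact (n + 2) * s\<^sup>2"
    using True by (simp add: y_def exp_minus field_simps power_add power2_eq_square del: fact_Suc)
  then show ?thesis
    using True by (simp add: flat_def y_def del: fact_Suc)
qed (simp add: flat_def)

lemma has_real_derivative_flat:
  "(flat n has_real_derivative flat (n + 2) s - real n * flat (n + 1) s) (at s)"
proof -
  consider "s > 0" | "s < 0" | "s = 0"
    by linarith
  then show ?thesis
  proof cases
    case 1
    have "((\<lambda>s. inverse s ^ n * exp (- inverse s)) has_real_derivative
        real n * inverse s ^ (n - 1) * (- (inverse s ^ 2)) * exp (- inverse s)
        + inverse s ^ n * (exp (- inverse s) * inverse s ^ 2)) (at s)"
      using 1 by (auto intro!: derivative_eq_intros simp: power2_eq_square)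
    moreover have "real n * inverse s ^ (n - 1) * (- (inverse s ^ 2)) * exp (- inverse s)
        + inverse s ^ n * (exp (- inverse s) * inverse s ^ 2)
        = flat (n + 2) s - real n * flat (n + 1) s"
      \<comment> \<open>For \<open>n = 0\<close> the exponent \<open>n - 1\<close> is truncated, but
        the factor \<open>real n\<close> kills that term.\<close>
      using 1 by (cases n) (simp_all add: flat_def power2_eq_square algebra_simps)
    ultimately have "((\<lambda>s. inverse s ^ n * exp (- inverse s)) has_real_derivative
        flat (n + 2) s - real n * flat (n + 1) s) (at s)"
      by (simp only:)
    then show ?thesis
      by (rule has_field_derivative_transform_within[where d = s])
        (use 1 in \<open>auto simp: flat_def dist_real_def\<close>)
  next
    case 2
    have "((\<lambda>s. 0) has_real_derivative flat (n + 2) s - real n * flat (n + 1) s) (at s)"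
      using 2 by (simp add: flat_def)
    then show ?thesis
      by (rule has_field_derivative_transform_within[where d = "- s"])
        (use 2 in \<open>auto simp: flat_def dist_real_def\<close>)
  next
    case 3
    have "((\<lambda>h. flat n h / h) \<longlongrightarrow> 0) (at 0)"
    proof (rule Lim_null_comparison)
      have "norm (flat n h / h) \<le> fact (n + 2) * \<bar>h\<bar>" for h
        using flat_le_square[of n h]
        by (cases "h = 0") (simp_all add: field_simps power2_eq_square del: fact_Suc)
      then show "\<forall>\<^sub>F h in at 0. norm (flat n h / h) \<le> fact (n + 2) * \<bar>h\<bar>"
        by simp
      show "((\<lambda>h::real. fact (n + 2) * \<bar>h\<bar>) \<longlongrightarrow> 0) (at 0)"
        by (auto intro!: tendsto_eq_intros)
    qed
    then show ?thesis
      using 3 by (simp add: DERIV_def flat_def)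
  qed
qed

text \<open>An algebra of functions that is closed under directional derivatives.\<close>

inductive bump_algebra :: "('a::euclidean_space \<Rightarrow> real) \<Rightarrow> bool"
  where
    const: "bump_algebra (\<lambda>x. c)"
  | inner: "bump_algebra (\<lambda>x. x \<bullet> v)"
  | flat: "bump_algebra (\<lambda>x. flat n (1 - x \<bullet> x))"
  | add: "bump_algebra g \<Longrightarrow> bump_algebra h \<Longrightarrow> bump_algebra (\<lambda>x. g x + h x)"
  | mult: "bump_algebra g \<Longrightarrow> bump_algebra h \<Longrightarrow> bump_algebra (\<lambda>x. g x * h x)"

lemma bump_algebra_derivative:
  assumes "bump_algebra g"
  shows "\<exists>D. (\<forall>x. (g has_derivative D x) (at x)) \<and> (\<forall>v. bump_algebra (\<lambda>x. D x v))"
  using assms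
proof induction
  case (const c)
  show ?case
    by (rule exI[of _ "\<lambda>x v. 0"]) (auto intro: bump_algebra.const)
next
  case (inner w)
  show ?case
    by (rule exI[of _ "\<lambda>x v. v \<bullet> w"])
      (auto intro!: derivative_eq_intros bump_algebra.const)
next
  case (flat n)
  \<comment> \<open>Signs are written as constant factors so that \<open>?D x v\<close> matches the
    closure rules of \<open>bump_algebra\<close> literally.\<close>
  let ?D = "\<lambda>x v. (flat (n + 2) (1 - x \<bullet> x) + (- real n) * flat (n + 1) (1 - x \<bullet> x))
    * ((- 2) * (x \<bullet> v))"
  have "((\<lambda>x. flat n (1 - x \<bullet> x)) has_derivative ?D x) (at x)" for x :: 'a
  proof -
    have "((\<lambda>x. 1 - x \<bullet> x) has_derivative (\<lambda>v. (- 2) * (x \<bullet> v))) (at x)"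
      by (auto intro!: derivative_eq_intros simp: inner_commute)
    from DERIV_compose_FDERIV[OF has_real_derivative_flat this] show ?thesis
      by (simp add: mult.commute)
  qed
  moreover have "bump_algebra (\<lambda>x. ?D x v)" for v :: 'a
    by (intro bump_algebra.intros)
  ultimately show ?case
    by (intro exI[of _ ?D]) blast
next
  case (add g h)
  then obtain D E
    where D: "\<And>x. (g has_derivative D x) (at x)" "\<And>v. bump_algebra (\<lambda>x. D x v)"
      and E: "\<And>x. (h has_derivative E x) (at x)" "\<And>v. bump_algebra (\<lambda>x. E x v)"
    by blast
  show ?case
    using has_derivative_add[OF D(1) E(1)] bump_algebra.add[OF D(2) E(2)]
    by (intro exI[of _ "\<lambda>x v. D x v + E x v"]) simp
next
  case (mult g h)
  then obtain D E
    where D: "\<And>x. (g has_derivative D x) (at x)" "\<And>v. bump_algebra (\<lambda>x. D x v)"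
      and E: "\<And>x. (h has_derivative E x) (at x)" "\<And>v. bump_algebra (\<lambda>x. E x v)"
    by blast
  have "bump_algebra (\<lambda>x. g x * E x v + D x v * h x)" for v
    using mult.hyps D(2) E(2) by (intro bump_algebra.add bump_algebra.mult)
  then show ?case
    using has_derivative_mult[OF D(1) E(1)]
    by (intro exI[of _ "\<lambda>x v. g x * E x v + D x v * h x"]) simp
qed

text \<open>Each directional derivative has the same form with another \<open>g\<close> from the
  algebra, so the induction on \<open>k\<close> keeps \<open>g\<close> arbitrary.\<close>

lemma Ck_bump_algebra_scaleR:
  "bump_algebra g \<Longrightarrow> Ck k (\<lambda>x. g x *\<^sub>R q)"
proof (induction k arbitrary: g)
  case 0
  then obtain D where "\<And>x. (g has_derivative D x) (at x)"
    using bump_algebra_derivative by blast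
  then have "continuous_on UNIV g"
    by (meson continuous_at_imp_continuous_on has_derivative_continuous)
  then show ?case
    by (simp add: continuous_on_scaleR)
next
  case (Suc k)
  then obtain D where D: "\<And>x. (g has_derivative D x) (at x)"
    and alg: "\<And>v. bump_algebra (\<lambda>x. D x v)"
    using bump_algebra_derivative by blast
  have *: "((\<lambda>x. g x *\<^sub>R q) has_derivative (\<lambda>v. D x v *\<^sub>R q)) (at x)" for x
    using D by (rule has_derivative_scaleR_left)
  have "frechet_derivative (\<lambda>x. g x *\<^sub>R q) (at x) = (\<lambda>v. D x v *\<^sub>R q)" for x
    using * by (metis frechet_derivative_at)
  moreover have "(\<lambda>x. g x *\<^sub>R q) differentiable_on UNIV"
    using * by (auto simp: differentiable_on_def differentiable_def)
  ultimately show ?case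
    using Suc.IH[OF alg] by simp
qed

lemma smooth_bump_exists:
  fixes q :: "'b::euclidean_space"
  obtains f :: "'a::euclidean_space \<Rightarrow> 'b"
  where "smooth_compactly_supported f" "f 0 = q" "\<And>x. norm x \<ge> 1 \<Longrightarrow> f x = 0"
proof
  \<comment> \<open>The factor \<open>exp 1\<close> cancels \<open>flat 0 1 = exp (- 1)\<close>. The
    squared norm keeps the argument smooth at the origin.\<close>
  define f :: "'a \<Rightarrow> 'b" where "f x = (exp 1 * flat 0 (1 - x \<bullet> x)) *\<^sub>R q" for x
  show zero: "f x = 0" if "norm x \<ge> 1" for x
    using one_le_power[OF that, of 2] by (simp add: f_def flat_def power2_norm_eq_inner)
  show "f 0 = q"
    by (simp add: f_def flat_def flip: exp_add)
  have "Ck k f" for k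
    unfolding f_def by (intro Ck_bump_algebra_scaleR bump_algebra.intros)
  moreover have "support_on UNIV f \<subseteq> cball 0 1"
    using zero by (force simp: support_on_def)
  then have "compact (closure (support_on UNIV f))"
    by (meson bounded_cball bounded_subset compact_closure)
  ultimately show "smooth_compactly_supported f"
    by (simp add: smooth_compactly_supported_def)
qed

lemma smooth_compactly_supported_continuous_on:
  "smooth_compactly_supported f \<Longrightarrow> continuous_on S f"
  by (metis Ck.simps(1) continuous_on_subset smooth_compactly_supported_def subset_UNIV)

subsection \<open>The space of continuous functions on a compact set\<close>

text \<open>Points of \<open>cfunspace\<close> must be bounded; compactness of \<open>K\<close>
  supplies this for continuous maps.\<close>

lemma restrict_in_C_space:
  fixes g :: "'a::topological_space \<Rightarrow> 'b::metric_space"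
  assumes "compact K" "continuous_on K g"
  shows "restrict g K \<in> mspace (C_space K)"
proof -
  have "continuous_on K (restrict g K)"
    using assms(2) by (simp cong: continuous_on_cong)
  moreover have "mspace (C_space K :: ('a \<Rightarrow> 'b) metric) = {f \<in> extensional K. continuous_on K f}"
    using assms(1) compactin_mspace_cfunspace[of "top_of_set K" euclidean_metric]
    by (simp add: compactin_subtopology del: mspace_cfunspace)
  ultimately show ?thesis
    by (simp del: mspace_cfunspace)
qed

text \<open>The supremum metric bounds every pointwise distance, so the ball of radius
  \<open>c\<close> about \<open>restrict f K\<close> misses \<open>S\<close>.\<close>

lemma restrict_notin_closure_C_space:
  fixes f :: "'a::topological_space \<Rightarrow> 'b::metric_space"
  assumes K: "compact K" and S: "S \<subseteq> mspace (C_space K)" and "c > 0"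
    and far: "\<And>g. g \<in> S \<Longrightarrow> \<exists>x\<in>K. dist (f x) (g x) \<ge> c"
  shows "restrict f K \<notin> mtopology_of (C_space K) closure_of S"
proof
  assume "restrict f K \<in> mtopology_of (C_space K) closure_of S"
  then obtain g where f: "restrict f K \<in> mspace (C_space K)" and g: "g \<in> S"
    and less: "mdist (C_space K) (restrict f K) g < c"
    using \<open>c > 0\<close>
    unfolding mtopology_of_def Metric_space.metric_closure_of[OF Metric_space_mspace_mdist]
    by (auto simp: Metric_space.in_mball[OF Metric_space_mspace_mdist] simp del: mspace_cfunspace)
  obtain x where x: "x \<in> K" "dist (f x) (g x) \<ge> c"
    using far g by blast
  have "mdist euclidean_metric (restrict f K x) (g x) \<le> mdist (C_space K) (restrict f K) g"
    using mdist_cfunspace_imp_mdist_le[OF f _ order_refl, of g x] g S x by auto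
  then show False
    using x less by simp
qed

subsection \<open>A map far from all time maps\<close>

lemma time_map_far_from_exchange:
  "\<exists>(f :: 'a::euclidean_space \<Rightarrow> 'a) c. smooth_compactly_supported f \<and> c > 0 \<and>
    (\<forall>\<Psi> T. continuous_semiflow \<Psi> \<longrightarrow> T \<ge> 0 \<longrightarrow> (\<exists>x\<in>cball 0 4. norm (\<Psi> T x - f x) \<ge> c))"
proof -
  \<comment> \<open>With norm 3, the ball \<open>ball q 1\<close> lies inside
    \<open>cball 0 4\<close> and outside the unit ball, hence where \<open>f\<close>
    vanishes.\<close>
  obtain q :: 'a where q: "norm q = 3"
    using vector_choose_size[of 3] by auto
  obtain f :: "'a \<Rightarrow> 'a" where f: "smooth_compactly_supported f" "f 0 = q"
      "\<And>x. norm x \<ge> 1 \<Longrightarrow> f x = 0"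
    using smooth_bump_exists[of q] by blast
  have "continuous_on UNIV f"
    using f(1) by (rule smooth_compactly_supported_continuous_on)
  then obtain d where "d > 0" and d: "\<And>x. dist x 0 < d \<Longrightarrow> dist (f x) q < 1/2"
    using f(2) unfolding continuous_on_iff by (metis UNIV_I half_gt_zero zero_less_one)
  \<comment> \<open>Halving \<open>d\<close> puts the closed ball inside the region where
    \<open>f\<close> is close to \<open>q\<close>; the bound 1 keeps it away from
    \<open>ball q 1\<close>.\<close>
  define r where "r = min (d / 2) 1"
  have r: "0 < r" "r < d" "r \<le> 1"
    using \<open>d > 0\<close> by (auto simp: r_def)
  \<comment> \<open>An error below 1/2 adds to the 1/2 from continuity and stays within
    \<open>ball q 1\<close>; an error below \<open>r\<close> sends \<open>ball q 1\<close>, where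
    \<open>f\<close> is 0, into \<open>ball 0 r\<close>.\<close>
  have "\<exists>x\<in>cball 0 4. norm (\<Psi> T x - f x) \<ge> min r (1/2)"
    if \<Psi>: "continuous_semiflow \<Psi>" and "T \<ge> 0" for \<Psi> T
  proof (rule ccontr)
    assume "\<not> ?thesis"
    then have close: "dist (\<Psi> T x) (f x) < min r (1/2)" if "norm x \<le> 4" for x
      using that by (force simp: dist_norm)
    have far: "norm x > 2" "norm x < 4" if "dist q x < 1" for x
      using that q norm_triangle_ineq2[of q x] norm_triangle_ineq3[of q x] by (auto simp: dist_norm)
    show False
    proof (rule continuous_semiflow_no_exchange[OF \<Psi> \<open>T \<ge> 0\<close> r(1)])
      show "\<Psi> T x \<in> ball q 1" if "x \<in> cball 0 r" for x
        using close[of x] d[of x] that r dist_triangle[of q "\<Psi> T x" "f x"]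
        by (simp add: dist_commute)
      show "\<Psi> T x \<in> ball 0 r" if "x \<in> ball q 1" for x
        using close[of x] far[of x] that f(3)[of x] by simp
      show "ball q 1 \<inter> cball 0 r = {}"
        using far r by force
    qed
  qed
  moreover have "min r (1/2) > 0"
    using r by simp
  ultimately show ?thesis
    using f(1) by blast
qed

theorem corollary2p9:
  fixes T :: real
  assumes "T > 0"
  shows "\<exists>(K :: (real ^ 'n) set) (f :: real ^ 'n \<Rightarrow> real ^ 'n) (c :: real).
    (\<exists>a r. r > 0 \<and> K = cball a r) \<and>
    smooth_compactly_supported f \<and>
    c > 0 \<and>
    (\<forall>\<Psi>. continuous_semiflow \<Psi> \<longrightarrow> (SUP x\<in>K. norm (\<Psi> T x - f x)) \<ge> c) \<and>
    mtopology_of (C_space K) closure_of time_maps T K \<noteq> mspace (C_space K)"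
proof -
  obtain f :: "real ^ 'n \<Rightarrow> real ^ 'n" and c
    where f: "smooth_compactly_supported f" and "c > 0"
      and far: "\<And>\<Psi>. continuous_semiflow \<Psi> \<Longrightarrow> \<exists>x\<in>cball 0 4. norm (\<Psi> T x - f x) \<ge> c"
    using time_map_far_from_exchange[where 'a = "real ^ 'n"] assms by (metis less_imp_le)
  define K :: "(real ^ 'n) set" where "K = cball 0 4"
  have K: "compact K"
    by (simp add: K_def)
  have sup: "(SUP x\<in>K. norm (\<Psi> T x - f x)) \<ge> c" if \<Psi>: "continuous_semiflow \<Psi>" for \<Psi>
  proof -
    have "continuous_on K (\<lambda>x. norm (\<Psi> T x - f x))"
      using \<Psi> assms f
      by (intro continuous_intros continuous_semiflow_continuous_on_space
          smooth_compactly_supported_continuous_on[of f]) auto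
    \<comment> \<open>A value is known to lie below the real supremum only once the set is bounded
      above.\<close>
    then have "bdd_above ((\<lambda>x. norm (\<Psi> T x - f x)) ` K)"
      using K by (intro bounded_imp_bdd_above compact_imp_bounded compact_continuous_image)
    then show ?thesis
      using far[OF \<Psi>] by (auto simp: K_def intro: cSUP_upper2)
  qed
  \<comment> \<open>Density fails at \<open>f\<close> itself.\<close>
  have "restrict f K \<notin> mtopology_of (C_space K) closure_of time_maps T K"
  proof (rule restrict_notin_closure_C_space[OF K _ \<open>c > 0\<close>])
    show "time_maps T K \<subseteq> mspace (C_space K)"
      using K assms restrict_in_C_space continuous_semiflow_continuous_on_space
      unfolding time_maps_def by (smt (verit) mem_Collect_eq subsetI)
    show "\<exists>x\<in>K. dist (f x) (g x) \<ge> c" if "g \<in> time_maps T K" for g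
      using that far by (fastforce simp: time_maps_def K_def dist_norm norm_minus_commute)
  qed
  moreover have "restrict f K \<in> mspace (C_space K)"
    using K f by (intro restrict_in_C_space smooth_compactly_supported_continuous_on)
  ultimately have "mtopology_of (C_space K) closure_of time_maps T K \<noteq> mspace (C_space K)"
    by blast
  moreover have "\<exists>a r. r > 0 \<and> K = cball a r"
    unfolding K_def by (intro exI[of _ 0] exI[of _ 4]) simp
  ultimately show ?thesis
    using f \<open>c > 0\<close> sup by blast
qed

end
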